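(* Let $k\ge1$ and $n\ge1$. The family $\mathcal{F}_n(k)$ of $F_{k,k+2}$-increasing trees of order $n$ is in bijection with the family $\mathcal{B}_n(k)$ of $k$-bundled increasing trees of order $n$.
   Context: A $k$-bundled increasing tree of order $n$ is a rooted tree with vertex set $\{1,\dots,n\}$, root $1$, labels increasing along paths away from the root, in which every vertex has $k$ ordered bundles, each containing a (possibly empty) linearly ordered sequence of children; each non-root vertex lies in exactly one bundle of its parent. An $F_{k,k+2}$-increasing tree of order $n$ is a rooted tree on $\{1,\dots,n\}$ with root $1$ and labels increasing along paths away from the root, in which the root has $k$ positions and every other vertex has $k+2$ positions (numbered from left to right), each position empty or occupied by exactly one child, and every non-root vertex occupies exactly one position of its parent. *)

theory Defs
  imports Main
begin

text \<open>A rooted tree is given by its parent-to-child relation: the pair \<open>(u, v)\<close> is in \<open>E\<close> iff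
  \<open>u\<close> is the parent of \<open>v\<close>.\<close>

definition rooted_tree :: "'a set \<Rightarrow> 'a \<Rightarrow> ('a \<times> 'a) set \<Rightarrow> bool" where
  "rooted_tree V r E \<longleftrightarrow>
     r \<in> V \<and> E \<subseteq> V \<times> V \<and>
     (\<forall>u. (u, r) \<notin> E) \<and>
     (\<forall>v\<in>V - {r}. \<exists>!u. (u, v) \<in> E) \<and>
     (\<forall>v\<in>V. (r, v) \<in> E\<^sup>*)"

definition increasing_tree :: "nat \<Rightarrow> (nat \<times> nat) set \<Rightarrow> bool" where
  "increasing_tree n E \<longleftrightarrow> rooted_tree {1..n} 1 E \<and> (\<forall>(u, v)\<in>E\<^sup>+. u < v)"

text \<open>In a bundled tree, \<open>b u i\<close> lists the children in bundle \<open>i \<in> {1..k}\<close> of the vertex \<open>u\<close>, in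
  their linear order. Arguments \<open>(u, i)\<close> that do not denote a bundle are sent to \<open>[]\<close>, so that
  distinct functions are distinct trees.\<close>

definition bundle_edges :: "nat \<Rightarrow> (nat \<Rightarrow> nat \<Rightarrow> nat list) \<Rightarrow> (nat \<times> nat) set" where
  "bundle_edges k b = {(u, v). \<exists>i\<in>{1..k}. v \<in> set (b u i)}"

definition bundled_increasing_trees :: "nat \<Rightarrow> nat \<Rightarrow> (nat \<Rightarrow> nat \<Rightarrow> nat list) set" where
  "bundled_increasing_trees k n =
     {b. increasing_tree n (bundle_edges k b) \<and>
         (\<forall>u i. distinct (b u i)) \<and>
         (\<forall>(u, v)\<in>bundle_edges k b. \<exists>!i. i \<in> {1..k} \<and> v \<in> set (b u i)) \<and>
         (\<forall>u i. u \<notin> {1..n} \<or> i \<notin> {1..k} \<longrightarrow> b u i = [])}"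

text \<open>In an \<open>F\<close>-tree, \<open>f u i\<close> is the child of \<open>u\<close> in position \<open>i\<close>, or \<open>None\<close> if that position is
  empty. Arguments \<open>(u, i)\<close> that do not denote a position are sent to \<open>None\<close>.\<close>

definition F_positions :: "nat \<Rightarrow> nat \<Rightarrow> nat set" where
  "F_positions k u = (if u = 1 then {1..k} else {1..k + 2})"

definition F_edges :: "nat \<Rightarrow> (nat \<Rightarrow> nat \<Rightarrow> nat option) \<Rightarrow> (nat \<times> nat) set" where
  "F_edges k f = {(u, v). \<exists>i\<in>F_positions k u. f u i = Some v}"

definition F_increasing_trees :: "nat \<Rightarrow> nat \<Rightarrow> (nat \<Rightarrow> nat \<Rightarrow> nat option) set" where
  "F_increasing_trees k n =
     {f. increasing_tree n (F_edges k f) \<and>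
         (\<forall>(u, v)\<in>F_edges k f. \<exists>!i. i \<in> F_positions k u \<and> f u i = Some v) \<and>
         (\<forall>u i. u \<notin> {1..n} \<or> i \<notin> F_positions k u \<longrightarrow> f u i = None)}"

end

theory Submission imports Defs begin

text \<open>Removing the largest label from a tree of order \<open>n + 1\<close> leaves a tree of order \<open>n\<close>, so each
  family grows by choosing a place for the new leaf. A bundled tree of order \<open>n\<close> has \<open>n k\<close> bundles
  holding \<open>n - 1\<close> vertices in total, hence \<open>n k + (n - 1)\<close> gaps for the leaf. An \<open>F\<close>-tree of order
  \<open>n\<close> has \<open>k + (n - 1) (k + 2)\<close> positions, of which \<open>n - 1\<close> are occupied, hence also
  \<open>n k + (n - 1)\<close> free ones. The two finite families therefore have the same cardinality.\<close>

section \<open>Local description of increasing trees\<close>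

text \<open>Edges that increase labels cannot form a cycle, and climbing from a vertex to its ever
  smaller parents must end at 1. The global tree conditions thus reduce to conditions on single
  edges, which are easy to check when a leaf is added or removed.\<close>

lemma increasing_tree_iff:
  assumes "n \<ge> 1"
  shows "increasing_tree n E \<longleftrightarrow>
    (\<forall>u v. (u, v) \<in> E \<longrightarrow> 1 \<le> u \<and> u < v \<and> v \<le> n) \<and> (\<forall>v\<in>{2..n}. \<exists>!u. (u, v) \<in> E)"
    (is "_ \<longleftrightarrow> ?order \<and> ?parent")
proof
  have V: "{1..n} - {1} = {2..n}" by auto
  {
    assume "increasing_tree n E"
    then have E: "E \<subseteq> {1..n} \<times> {1..n}" and p: "\<forall>v\<in>{1..n} - {1}. \<exists>!u. (u, v) \<in> E"
      and lt: "\<forall>(u, v)\<in>E\<^sup>+. u < v"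
      by (auto simp: increasing_tree_def rooted_tree_def)
    from p have ?parent unfolding V .
    moreover have ?order using E lt by fastforce
    ultimately show "?order \<and> ?parent" by blast
  }
  {
    assume A: "?order \<and> ?parent"
    have lt: "u < v" if "(u, v) \<in> E\<^sup>+" for u v
      using that by (induction rule: trancl_induct) (use A in \<open>auto intro: less_trans\<close>)
    \<comment> \<open>Strong induction on the label: the parent of \<open>v\<close> is smaller, so
      it is already reachable from 1.\<close>
    have reach: "v \<in> {1..n} \<longrightarrow> (1, v) \<in> E\<^sup>*" for v
    proof (induction v rule: less_induct)
      case (less v)
      show ?case
      proof (cases "v \<in> {2..n}")
        case True
        then obtain u where u: "(u, v) \<in> E" using A by blast
        then have "1 \<le> u" "u < v" "v \<le> n" using A by auto
        then have "(1, u) \<in> E\<^sup>*" using less by auto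
        then show ?thesis using u by (auto intro: rtrancl_into_rtrancl)
      next
        case False
        then have "v \<in> {1..n} \<longrightarrow> v = 1" by auto
        then show ?thesis by auto
      qed
    qed
    have "E \<subseteq> {1..n} \<times> {1..n}" using A by fastforce
    moreover have "\<forall>u. (u, 1) \<notin> E" using A by fastforce
    moreover have "\<forall>v\<in>{1..n} - {1}. \<exists>!u. (u, v) \<in> E" unfolding V using A by blast
    ultimately have "rooted_tree {1..n} 1 E"
      using reach assms unfolding rooted_tree_def by auto
    then show "increasing_tree n E" using lt by (auto simp: increasing_tree_def)
  }
qed

section \<open>Trees as placements of labels\<close>

text \<open>\<open>L u i v\<close> says that \<open>v\<close> is a child of \<open>u\<close> in bundle or position \<open>i\<close>.\<close>

definition placement_tree :: "nat \<Rightarrow> (nat \<Rightarrow> 'i \<Rightarrow> nat \<Rightarrow> bool) \<Rightarrow> bool" where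
  "placement_tree n L \<longleftrightarrow>
    (\<forall>u i v. L u i v \<longrightarrow> 1 \<le> u \<and> u < v \<and> v \<le> n) \<and>
    (\<forall>v\<in>{2..n}. \<exists>u i. L u i v) \<and>
    (\<forall>u i u' i' v. L u i v \<longrightarrow> L u' i' v \<longrightarrow> u' = u \<and> i' = i)"

lemma placement_treeD:
  assumes "placement_tree n L"
  shows "L u i v \<Longrightarrow> 1 \<le> u" "L u i v \<Longrightarrow> u < v" "L u i v \<Longrightarrow> v \<le> n"
    "L u i v \<Longrightarrow> L u' i' v \<Longrightarrow> u' = u \<and> i' = i" "v \<in> {2..n} \<Longrightarrow> \<exists>u i. L u i v"
  using assms unfolding placement_tree_def by blast+

text \<open>A unique parent together with a unique index inside that parent amounts to a unique pair
  \<open>(u, i)\<close>. Both families are instances: \<open>L\<close> is list membership with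
  \<open>I\<close> constant, or occupation of a position with \<open>I\<close> equal to
  \<open>F_positions k\<close>.\<close>

lemma placement_tree_iff:
  assumes "n \<ge> 1" and L: "\<And>u i v. L u i v \<Longrightarrow> i \<in> I u"
  shows "increasing_tree n {(u, v). \<exists>i\<in>I u. L u i v} \<and>
      (\<forall>(u, v)\<in>{(u, v). \<exists>i\<in>I u. L u i v}. \<exists>!i. i \<in> I u \<and> L u i v) \<longleftrightarrow> placement_tree n L"
    (is "increasing_tree n ?E \<and> ?unique \<longleftrightarrow> _")
proof
  have E: "(u, v) \<in> ?E \<longleftrightarrow> (\<exists>i. L u i v)" for u v using L by auto
  {
    assume "increasing_tree n ?E \<and> ?unique"
    then have order: "L u i v \<Longrightarrow> 1 \<le> u \<and> u < v \<and> v \<le> n"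
      and parent: "v \<in> {2..n} \<Longrightarrow> \<exists>!u. \<exists>i. L u i v"
      and position: "L u i v \<Longrightarrow> L u i' v \<Longrightarrow> i' = i" for u i i' v
      unfolding increasing_tree_iff[OF assms(1)] E using L by blast+
    have "u' = u \<and> i' = i" if "L u i v" "L u' i' v" for u i u' i' v
    proof -
      have "v \<in> {2..n}" using order[OF that(1)] by auto
      then have "u' = u" using parent that by blast
      then show ?thesis using position that by blast
    qed
    then show "placement_tree n L"
      using order parent unfolding placement_tree_def by blast
  }
  {
    assume A: "placement_tree n L"
    have "increasing_tree n ?E"
      unfolding increasing_tree_iff[OF assms(1)] E
      using A unfolding placement_tree_def by blast
    moreover have ?unique using placement_treeD(4)[OF A] L by blast
    ultimately show "increasing_tree n ?E \<and> ?unique" by blast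
  }
qed

text \<open>Each label in \<open>{2..n}\<close> is placed exactly once, so projecting a triple to
  its label is a bijection onto \<open>{2..n}\<close>.\<close>

lemma card_placements:
  assumes "placement_tree n L"
  shows "finite {(u, i). \<exists>v. L u i v}" "card {(u, i, v). L u i v} = n - 1"
proof -
  have bij: "bij_betw (\<lambda>(u, i, v). v) {(u, i, v). L u i v} {2..n}"
    unfolding bij_betw_def inj_on_def
  proof (intro conjI)
    show "(\<lambda>(u, i, v). v) ` {(u, i, v). L u i v} = {2..n}"
      using placement_treeD[OF assms] by (fastforce simp: image_iff)
  qed (use placement_treeD(4)[OF assms] in fastforce)
  then show "card {(u, i, v). L u i v} = n - 1"
    by (simp add: bij_betw_same_card)
  have "{(u, i). \<exists>v. L u i v} = (\<lambda>(u, i, v). (u, i)) ` {(u, i, v). L u i v}"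
    by (auto simp: image_iff)
  then show "finite {(u, i). \<exists>v. L u i v}"
    using bij_betw_finite[OF bij] by simp
qed

text \<open>Old placements only involve labels up to \<open>n\<close>, so the new label clashes with
  none of them and exceeds its parent.\<close>

lemma placement_tree_insert:
  assumes "placement_tree n L" "n \<ge> 1" "u \<in> {1..n}"
  shows "placement_tree (Suc n) (\<lambda>u' i' v. L u' i' v \<or> u' = u \<and> i' = i \<and> v = Suc n)"
  unfolding placement_tree_def
proof (intro conjI allI ballI impI)
  fix v assume "v \<in> {2..Suc n}"
  then have "v \<in> {2..n} \<or> v = Suc n" by auto
  then show "\<exists>u' i'. L u' i' v \<or> u' = u \<and> i' = i \<and> v = Suc n"
    using placement_treeD(5)[OF assms(1)] by blast
qed (use placement_treeD(1-4)[OF assms(1)] assms(3) in fastforce)+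

text \<open>The largest label is a leaf, since a child would have to be larger still; deleting it
  orphans no vertex.\<close>

lemma placement_tree_remove:
  assumes "placement_tree (Suc n) L"
  shows "placement_tree n (\<lambda>u i v. L u i v \<and> v \<noteq> Suc n)"
  unfolding placement_tree_def
  using placement_treeD(1,2,4)[OF assms]
proof (intro conjI allI ballI impI)
  show "v \<le> n" if "L u i v \<and> v \<noteq> Suc n" for u i v
    using placement_treeD(3)[OF assms, of u i v] that by auto
  show "\<exists>u i. L u i v \<and> v \<noteq> Suc n" if "v \<in> {2..n}" for v
    using placement_treeD(5)[OF assms, of v] that by auto
qed blast+

text \<open>The default value \<open>[]\<close> for \<open>u\<close> outside \<open>{1..n}\<close>
  is forced by the bounds on parents in \<open>placement_tree\<close>, so only the condition on
  \<open>i\<close> has to be kept.\<close>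

lemma bundled_increasing_trees_eq:
  assumes "n \<ge> 1"
  shows "bundled_increasing_trees k n =
    {b. placement_tree n (\<lambda>u i v. v \<in> set (b u i)) \<and> (\<forall>u i. distinct (b u i)) \<and>
        (\<forall>u i v. v \<in> set (b u i) \<longrightarrow> i \<in> {1..k})}"
proof (intro set_eqI iffI)
  fix b assume b: "b \<in> bundled_increasing_trees k n"
  then have "i \<notin> {1..k} \<Longrightarrow> b u i = []" for u i
    unfolding bundled_increasing_trees_def by blast
  then have "v \<in> set (b u i) \<Longrightarrow> i \<in> {1..k}" for u i v
    by (metis empty_iff list.set(1))
  with b show "b \<in> {b. placement_tree n (\<lambda>u i v. v \<in> set (b u i)) \<and> (\<forall>u i. distinct (b u i)) \<and>
        (\<forall>u i v. v \<in> set (b u i) \<longrightarrow> i \<in> {1..k})}"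
    using placement_tree_iff[OF assms, of "\<lambda>u i v. v \<in> set (b u i)" "\<lambda>_. {1..k}"]
    unfolding bundled_increasing_trees_def bundle_edges_def by blast
next
  fix b assume "b \<in> {b. placement_tree n (\<lambda>u i v. v \<in> set (b u i)) \<and> (\<forall>u i. distinct (b u i)) \<and>
        (\<forall>u i v. v \<in> set (b u i) \<longrightarrow> i \<in> {1..k})}"
  then have b: "placement_tree n (\<lambda>u i v. v \<in> set (b u i))" "\<forall>u i. distinct (b u i)"
    and i: "\<And>u i v. v \<in> set (b u i) \<Longrightarrow> i \<in> {1..k}"
    by blast+
  have "b u i = []" if "u \<notin> {1..n} \<or> i \<notin> {1..k}" for u i
  proof (rule ccontr)
    assume "b u i \<noteq> []"
    then have v: "hd (b u i) \<in> set (b u i)" by simp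
    from placement_treeD(1-3)[OF b(1), OF v] i[OF v] that show False by auto
  qed
  then show "b \<in> bundled_increasing_trees k n"
    using placement_tree_iff[OF assms, of "\<lambda>u i v. v \<in> set (b u i)" "\<lambda>_. {1..k}"] b i
    unfolding bundled_increasing_trees_def bundle_edges_def by blast
qed

lemma F_increasing_trees_eq:
  assumes "n \<ge> 1"
  shows "F_increasing_trees k n =
    {f. placement_tree n (\<lambda>u i v. f u i = Some v) \<and>
        (\<forall>u i v. f u i = Some v \<longrightarrow> i \<in> F_positions k u)}"
proof (intro set_eqI iffI)
  fix f assume f: "f \<in> F_increasing_trees k n"
  then have "\<And>u i v. f u i = Some v \<Longrightarrow> i \<in> F_positions k u"
    unfolding F_increasing_trees_def by fastforce
  with f show "f \<in> {f. placement_tree n (\<lambda>u i v. f u i = Some v) \<and>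
        (\<forall>u i v. f u i = Some v \<longrightarrow> i \<in> F_positions k u)}"
    using placement_tree_iff[OF assms, of "\<lambda>u i v. f u i = Some v" "F_positions k"]
    unfolding F_increasing_trees_def F_edges_def by blast
next
  fix f assume "f \<in> {f. placement_tree n (\<lambda>u i v. f u i = Some v) \<and>
        (\<forall>u i v. f u i = Some v \<longrightarrow> i \<in> F_positions k u)}"
  then have f: "placement_tree n (\<lambda>u i v. f u i = Some v)"
    and i: "\<And>u i v. f u i = Some v \<Longrightarrow> i \<in> F_positions k u"
    by blast+
  have "f u i = None" if "u \<notin> {1..n} \<or> i \<notin> F_positions k u" for u i
  proof (cases "f u i")
    case (Some v)
    from placement_treeD(1-3)[OF f, OF Some] i[OF Some] that show ?thesis by auto
  qed
  then show "f \<in> F_increasing_trees k n"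
    using placement_tree_iff[OF assms, of "\<lambda>u i v. f u i = Some v" "F_positions k"] f i
    unfolding F_increasing_trees_def F_edges_def by blast
qed

section \<open>Leaf insertion in bundled trees\<close>

text \<open>The gap \<open>(u, i, j)\<close> lies after the first \<open>j\<close> entries of the
  bundle. The bound on \<open>j\<close> is inclusive: a list of length \<open>l\<close> has
  \<open>l + 1\<close> gaps.\<close>

definition bundle_gaps :: "nat \<Rightarrow> nat \<Rightarrow> (nat \<Rightarrow> nat \<Rightarrow> 'a list) \<Rightarrow> (nat \<times> nat \<times> nat) set" where
  "bundle_gaps k n b = (SIGMA u:{1..n}. SIGMA i:{1..k}. {..length (b u i)})"

text \<open>Each of the \<open>n * k\<close> bundles has one gap more than its length. The lists are
  distinct, so their lengths add up to the number of placed labels, \<open>n - 1\<close>.\<close>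

lemma card_bundle_gaps:
  assumes "n \<ge> 1" and b: "b \<in> bundled_increasing_trees k n"
  shows "finite (bundle_gaps k n b)" "card (bundle_gaps k n b) = n * k + (n - 1)"
proof -
  have t: "placement_tree n (\<lambda>u i v. v \<in> set (b u i))" and d: "\<And>u i. distinct (b u i)"
    and i: "\<And>u i v. v \<in> set (b u i) \<Longrightarrow> i \<in> {1..k}"
    using b unfolding bundled_increasing_trees_eq[OF assms(1)] by blast+
  have "{(u, i, v). v \<in> set (b u i)} = (SIGMA u:{1..n}. SIGMA i:{1..k}. set (b u i))"
    using placement_treeD(1-3)[OF t] i by fastforce
  then have "(\<Sum>u=1..n. \<Sum>i=1..k. card (set (b u i))) = n - 1"
    using card_placements(2)[OF t] by simp
  then have "(\<Sum>u=1..n. \<Sum>i=1..k. length (b u i)) = n - 1"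
    by (simp add: distinct_card[OF d])
  then show "card (bundle_gaps k n b) = n * k + (n - 1)"
    unfolding bundle_gaps_def by (simp add: sum_Suc sum.distrib)
  show "finite (bundle_gaps k n b)"
    unfolding bundle_gaps_def by auto
qed

definition bundle_insert ::
    "'a \<Rightarrow> (nat \<Rightarrow> nat \<Rightarrow> 'a list) \<times> nat \<times> nat \<times> nat \<Rightarrow> nat \<Rightarrow> nat \<Rightarrow> 'a list" where
  "bundle_insert x = (\<lambda>(b, u, i, j). b(u := (b u)(i := take j (b u i) @ x # drop j (b u i))))"

lemma set_bundle_insert:
  "v \<in> set (bundle_insert x (b, u, i, j) u' i') \<longleftrightarrow>
    v \<in> set (b u' i') \<or> u' = u \<and> i' = i \<and> v = x"
proof -
  have "set (take j (b u i)) \<union> set (drop j (b u i)) = set (b u i)"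
    by (metis append_take_drop_id set_append)
  then show ?thesis by (auto simp: bundle_insert_def)
qed

text \<open>As \<open>x\<close> is fresh, its first occurrence is the inserted one. This recovers
  the prefix, and with it the gap, from the enlarged list.\<close>

lemma takeWhile_insert:
  assumes "x \<notin> set xs"
  shows "takeWhile (\<lambda>y. y \<noteq> x) (take j xs @ x # drop j xs) = take j xs"
proof -
  have "y \<noteq> x" if "y \<in> set (take j xs)" for y
    using assms in_set_takeD[OF that] by auto
  then show ?thesis by (simp add: takeWhile_append2)
qed

text \<open>The inverse deletes \<open>Suc n\<close> from the one list containing it and records the
  gap where it stood.\<close>

lemma bij_betw_bundle_insert:
  assumes "n \<ge> 1"
  shows "bij_betw (bundle_insert (Suc n))
    (SIGMA b:bundled_increasing_trees k n. bundle_gaps k n b) (bundled_increasing_trees k (Suc n))"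
  (is "bij_betw _ ?S ?B")
  unfolding bij_betw_def
proof (intro conjI)
  note eq = bundled_increasing_trees_eq[OF assms]
  have "Suc n \<ge> 1" by simp
  note eq' = bundled_increasing_trees_eq[OF this]
  have new: "Suc n \<notin> set (b u i)" if "b \<in> bundled_increasing_trees k n" for b u i
  proof
    assume "Suc n \<in> set (b u i)"
    moreover have "placement_tree n (\<lambda>u i v. v \<in> set (b u i))" using that unfolding eq by blast
    ultimately show False using placement_treeD(3) by fastforce
  qed
  show "inj_on (bundle_insert (Suc n)) ?S"
  proof (rule inj_onI)
    fix p q assume pq: "p \<in> ?S" "q \<in> ?S" "bundle_insert (Suc n) p = bundle_insert (Suc n) q"
    obtain b u i j b' u' i' j' where p: "p = (b, u, i, j)" and q: "q = (b', u', i', j')"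
      by (metis prod_cases4)
    from pq have b: "b \<in> bundled_increasing_trees k n" "(u, i, j) \<in> bundle_gaps k n b"
      and b': "b' \<in> bundled_increasing_trees k n" "(u', i', j') \<in> bundle_gaps k n b'"
      and ins: "bundle_insert (Suc n) (b, u, i, j) = bundle_insert (Suc n) (b', u', i', j')"
      by (auto simp: p q)
    have j: "j \<le> length (b u i)" "j' \<le> length (b' u' i')"
      using b(2) b'(2) by (auto simp: bundle_gaps_def)
    \<comment> \<open>The label \<open>Suc n\<close> is fresh for \<open>b'\<close>, so finding it
      at \<open>(u, i)\<close> after the second insertion shows that this insertion happened there
      too.\<close>
    have "Suc n \<in> set (bundle_insert (Suc n) (b', u', i', j') u i)"
      unfolding ins[symmetric] set_bundle_insert by simp
    then have u: "u' = u" "i' = i"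
      unfolding set_bundle_insert using new[OF b'(1)] by auto
    have at: "take j (b u i) @ Suc n # drop j (b u i) = take j' (b' u i) @ Suc n # drop j' (b' u i)"
      using fun_cong[OF fun_cong[OF ins, of u], of i] u by (simp add: bundle_insert_def)
    have take: "take j (b u i) = take j' (b' u i)"
      using takeWhile_insert[OF new[OF b(1)]] takeWhile_insert[OF new[OF b'(1)]] at by metis
    \<comment> \<open>A gap index never exceeds the length of its list, so equal prefixes have equal
      indices.\<close>
    moreover have "length (take j (b u i)) = j" "length (take j' (b' u i)) = j'"
      using j u by auto
    ultimately have "j = j'" by simp
    moreover from at take have "b u i = b' u i"
      by (metis append_take_drop_id same_append_eq list.inject)
    moreover have "b x y = b' x y" if "x \<noteq> u \<or> y \<noteq> i" for x y
      using fun_cong[OF fun_cong[OF ins, of x], of y] u that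
      by (auto simp: bundle_insert_def split: if_splits)
    ultimately have "b = b'" "j = j'"
      by (metis ext)+
    then show "p = q"
      using u p q by simp
  qed
  show "bundle_insert (Suc n) ` ?S = ?B"
  proof (intro equalityI subsetI)
    fix c assume "c \<in> bundle_insert (Suc n) ` ?S"
    then obtain b u i j where c: "c = bundle_insert (Suc n) (b, u, i, j)"
      and b: "b \<in> bundled_increasing_trees k n" and g: "(u, i, j) \<in> bundle_gaps k n b"
      by auto
    have u: "u \<in> {1..n}" "i \<in> {1..k}" using g by (auto simp: bundle_gaps_def)
    have d: "distinct (b u' i')" for u' i' using b unfolding eq by blast
    have "distinct (c u' i')" for u' i'
      using d[of u' i'] d[of u i] new[OF b, of u i] set_take_disj_set_drop_if_distinct[OF d[of u i], of j j]
      by (auto simp: c bundle_insert_def dest: in_set_takeD in_set_dropD)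
    moreover have "placement_tree n (\<lambda>u i v. v \<in> set (b u i))" using b unfolding eq by blast
    then have "placement_tree (Suc n) (\<lambda>u i v. v \<in> set (c u i))"
      unfolding c set_bundle_insert by (rule placement_tree_insert[OF _ assms u(1)])
    moreover have "\<And>u' i' v. v \<in> set (c u' i') \<Longrightarrow> i' \<in> {1..k}"
      using b u(2) unfolding eq c set_bundle_insert by blast
    ultimately show "c \<in> ?B" unfolding eq' by blast
  next
    fix c assume "c \<in> ?B"
    then have t: "placement_tree (Suc n) (\<lambda>u i v. v \<in> set (c u i))"
      and d: "\<And>u i. distinct (c u i)"
      and pos: "\<And>u i v. v \<in> set (c u i) \<Longrightarrow> i \<in> {1..k}"
      unfolding eq' by blast+
    \<comment> \<open>\<open>Suc n\<close> is at least 2 because \<open>n\<close> is at least 1, so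
      it is not the root and has a parent.\<close>
    obtain u i where ui: "Suc n \<in> set (c u i)"
      using placement_treeD(5)[OF t, of "Suc n"] assms by auto
    then obtain ys zs where split: "c u i = ys @ Suc n # zs" by (meson split_list)
    define b where "b = c(u := (c u)(i := ys @ zs))"
    \<comment> \<open>One deletion removes every occurrence: distinctness excludes a second one in
      the same list, uniqueness of placement excludes one in any other list.\<close>
    have "Suc n \<notin> set ys \<union> set zs" using d[of u i] split by auto
    then have sets: "v \<in> set (b u' i') \<longleftrightarrow> v \<in> set (c u' i') \<and> v \<noteq> Suc n" for u' i' v
    proof (cases "u' = u \<and> i' = i")
      case False
      then have "Suc n \<notin> set (c u' i')" using placement_treeD(4)[OF t ui] by blast
      with False show ?thesis by (auto simp: b_def)
    qed (auto simp: b_def split)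
    have "distinct (b u' i')" for u' i'
      using d[of u' i'] d[of u i] split by (auto simp: b_def)
    then have "b \<in> bundled_increasing_trees k n"
      using placement_tree_remove[OF t] pos unfolding eq mem_Collect_eq sets by blast
    \<comment> \<open>The parent satisfies \<open>u < Suc n\<close>, so it is a vertex of the
      smaller tree.\<close>
    moreover have "(u, i, length ys) \<in> bundle_gaps k n b"
      using placement_treeD(1,2)[OF t ui] pos[OF ui] by (auto simp: bundle_gaps_def b_def)
    moreover have "c = bundle_insert (Suc n) (b, u, i, length ys)"
      using split by (auto simp: bundle_insert_def b_def fun_eq_iff)
    ultimately show "c \<in> bundle_insert (Suc n) ` ?S" by blast
  qed
qed

section \<open>Leaf insertion in F-trees\<close>

definition free_positions :: "nat \<Rightarrow> nat \<Rightarrow> (nat \<Rightarrow> nat \<Rightarrow> 'a option) \<Rightarrow> (nat \<times> nat) set" where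
  "free_positions k n f = {(u, i) \<in> Sigma {1..n} (F_positions k). f u i = None}"

text \<open>The occupied positions, one for each non-root vertex, are subtracted from all positions.
  The two extra positions of each non-root vertex thus leave a surplus of one, matching the gap that
  each listed child adds to a bundle.\<close>

lemma card_free_positions:
  assumes "n \<ge> 1" and f: "f \<in> F_increasing_trees k n"
  shows "finite (free_positions k n f)" "card (free_positions k n f) = n * k + (n - 1)"
proof -
  have t: "placement_tree n (\<lambda>u i v. f u i = Some v)"
    and i: "\<And>u i v. f u i = Some v \<Longrightarrow> i \<in> F_positions k u"
    using f unfolding F_increasing_trees_eq[OF assms(1)] by blast+
  let ?O = "{(u, i). \<exists>v. f u i = Some v}"
  have fin: "finite (F_positions k u)" for u by (simp add: F_positions_def)
  then show "finite (free_positions k n f)"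
    unfolding free_positions_def by (auto intro: finite_subset[of _ "Sigma {1..n} (F_positions k)"])
  have "free_positions k n f = Sigma {1..n} (F_positions k) - ?O"
    by (auto simp: free_positions_def)
  moreover have "?O \<subseteq> Sigma {1..n} (F_positions k)"
  proof clarify
    fix u i' v assume "f u i' = Some v"
    from placement_treeD(1-3)[OF t, OF this] i[OF this]
    show "u \<in> {1..n} \<and> i' \<in> F_positions k u" by auto
  qed
  \<comment> \<open>A position holds at most one child, so occupied positions are as many as placed
    labels.\<close>
  moreover have bij: "bij_betw (\<lambda>(u, i, v). (u, i)) {(u, i, v). f u i = Some v} ?O"
    unfolding bij_betw_def inj_on_def by (auto simp: image_iff)
  have "card ?O = n - 1"
    using card_placements(2)[OF t] bij_betw_same_card[OF bij] by simp
  moreover have "card (Sigma {1..n} (F_positions k)) = k + (n - 1) * (k + 2)"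
  proof -
    have "{1..n} = insert 1 {2..n}" using assms(1) by auto
    then have "(\<Sum>u=1..n. card (F_positions k u)) = k + (\<Sum>u=2..n. card (F_positions k u))"
      by (simp add: F_positions_def)
    also have "(\<Sum>u=2..n. card (F_positions k u)) = (\<Sum>u=2..n. k + 2)"
      by (rule sum.cong) (auto simp: F_positions_def)
    finally show ?thesis by (simp add: fin)
  qed
  ultimately have "card (free_positions k n f) = k + (n - 1) * (k + 2) - (n - 1)"
    by (simp add: card_Diff_subset card_placements(1)[OF t])
  \<comment> \<open>Writing \<open>n\<close> as \<open>Suc m\<close> eliminates the truncated
    subtractions.\<close>
  also obtain m where "n = Suc m" using assms(1) by (cases n) auto
  then have "k + (n - 1) * (k + 2) - (n - 1) = n * k + (n - 1)"
    by (simp add: algebra_simps)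
  finally show "card (free_positions k n f) = n * k + (n - 1)" .
qed

definition F_insert ::
    "'a \<Rightarrow> (nat \<Rightarrow> nat \<Rightarrow> 'a option) \<times> nat \<times> nat \<Rightarrow> nat \<Rightarrow> nat \<Rightarrow> 'a option" where
  "F_insert x = (\<lambda>(f, u, i). f(u := (f u)(i := Some x)))"

text \<open>Since the position is free, the update overwrites no child; the result has the form used
  in \<open>placement_tree_insert\<close>.\<close>

lemma F_insert_eq_Some:
  assumes "f u i = None"
  shows "F_insert x (f, u, i) u' i' = Some v \<longleftrightarrow> f u' i' = Some v \<or> u' = u \<and> i' = i \<and> v = x"
  using assms by (cases "u' = u"; cases "i' = i") (simp_all add: F_insert_def eq_commute)

text \<open>The inverse empties the position of \<open>Suc n\<close>. That position alone determines
  the insertion, as there is no order among siblings to recover.\<close>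

lemma bij_betw_F_insert:
  assumes "n \<ge> 1"
  shows "bij_betw (F_insert (Suc n))
    (SIGMA f:F_increasing_trees k n. free_positions k n f) (F_increasing_trees k (Suc n))"
  (is "bij_betw _ ?S ?F")
  unfolding bij_betw_def
proof (intro conjI)
  note eq = F_increasing_trees_eq[OF assms]
  have "Suc n \<ge> 1" by simp
  note eq' = F_increasing_trees_eq[OF this]
  have new: "f u i \<noteq> Some (Suc n)" if "f \<in> F_increasing_trees k n" for f u i
  proof
    assume "f u i = Some (Suc n)"
    moreover have "placement_tree n (\<lambda>u i v. f u i = Some v)" using that unfolding eq by blast
    ultimately show False using placement_treeD(3) by fastforce
  qed
  show "inj_on (F_insert (Suc n)) ?S"
  proof (rule inj_onI)
    fix p q assume pq: "p \<in> ?S" "q \<in> ?S" "F_insert (Suc n) p = F_insert (Suc n) q"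
    obtain f u i f' u' i' where p: "p = (f, u, i)" and q: "q = (f', u', i')"
      by (metis prod_cases3)
    from pq have f: "f \<in> F_increasing_trees k n" "(u, i) \<in> free_positions k n f"
      and f': "f' \<in> F_increasing_trees k n" "(u', i') \<in> free_positions k n f'"
      and ins: "F_insert (Suc n) (f, u, i) = F_insert (Suc n) (f', u', i')"
      by (auto simp: p q)
    have none: "f u i = None" "f' u' i' = None"
      using f(2) f'(2) by (auto simp: free_positions_def)
    have "F_insert (Suc n) (f', u', i') u i = Some (Suc n)"
      unfolding ins[symmetric] by (simp add: F_insert_def)
    then have u: "u' = u" "i' = i"
      unfolding F_insert_eq_Some[of f' u' i', OF none(2)] using new[OF f'(1)] by auto
    \<comment> \<open>Away from \<open>(u, i)\<close> neither insertion changes anything, and at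
      \<open>(u, i)\<close> both trees were empty.\<close>
    have "f x y = f' x y" for x y
      using fun_cong[OF fun_cong[OF ins, of x], of y] u none
      by (auto simp: F_insert_def split: if_splits)
    then have "f = f'" by blast
    then show "p = q" using u p q by simp
  qed
  show "F_insert (Suc n) ` ?S = ?F"
  proof (intro equalityI subsetI)
    fix g assume "g \<in> F_insert (Suc n) ` ?S"
    then obtain f u i where g: "g = F_insert (Suc n) (f, u, i)"
      and f: "f \<in> F_increasing_trees k n" and free: "(u, i) \<in> free_positions k n f"
      by auto
    have u: "u \<in> {1..n}" "i \<in> F_positions k u" "f u i = None"
      using free by (auto simp: free_positions_def)
    have "placement_tree n (\<lambda>u i v. f u i = Some v)" using f unfolding eq by blast
    then have "placement_tree (Suc n) (\<lambda>u i v. g u i = Some v)"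
      unfolding g F_insert_eq_Some[of f, OF u(3)] by (rule placement_tree_insert[OF _ assms u(1)])
    moreover have "\<And>u' i' v. g u' i' = Some v \<Longrightarrow> i' \<in> F_positions k u'"
      using f u(2) unfolding eq g F_insert_eq_Some[of f, OF u(3)] by blast
    ultimately show "g \<in> ?F" unfolding eq' by blast
  next
    fix g assume "g \<in> ?F"
    then have t: "placement_tree (Suc n) (\<lambda>u i v. g u i = Some v)"
      and pos: "\<And>u i v. g u i = Some v \<Longrightarrow> i \<in> F_positions k u"
      unfolding eq' by blast+
    obtain u i where ui: "g u i = Some (Suc n)"
      using placement_treeD(5)[OF t, of "Suc n"] assms by auto
    define f where "f = g(u := (g u)(i := None))"
    have some: "f u' i' = Some v \<longleftrightarrow> g u' i' = Some v \<and> v \<noteq> Suc n" for u' i' v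
    proof (cases "u' = u \<and> i' = i")
      case False
      then have "g u' i' \<noteq> Some (Suc n)" using placement_treeD(4)[OF t ui] by blast
      with False show ?thesis by (auto simp: f_def)
    qed (auto simp: f_def ui)
    have "f \<in> F_increasing_trees k n"
      using placement_tree_remove[OF t] pos unfolding eq mem_Collect_eq some by blast
    moreover have "(u, i) \<in> free_positions k n f"
      using placement_treeD(1,2)[OF t ui] pos[OF ui] by (auto simp: free_positions_def f_def)
    moreover have "g = F_insert (Suc n) (f, u, i)"
      using ui by (auto simp: F_insert_def f_def fun_eq_iff)
    ultimately show "g \<in> F_insert (Suc n) ` ?S" by blast
  qed
qed

section \<open>Order one and comparison of cardinalities\<close>

lemma placement_tree_1: "placement_tree 1 L \<longleftrightarrow> (\<forall>u i v. \<not> L u i v)"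
proof
  assume "placement_tree 1 L"
  from placement_treeD(1-3)[OF this] show "\<forall>u i v. \<not> L u i v" by force
qed (simp add: placement_tree_def)

lemma bundled_increasing_trees_1: "bundled_increasing_trees k 1 = {\<lambda>_ _. []}"
proof -
  have "(\<forall>u i v. v \<notin> set (b u i)) \<longleftrightarrow> b = (\<lambda>_ _. [])" for b :: "nat \<Rightarrow> nat \<Rightarrow> nat list"
    by (simp add: fun_eq_iff flip: set_empty ex_in_conv all_not_in_conv)
  then show ?thesis
    unfolding bundled_increasing_trees_eq[OF order_refl] placement_tree_1 by auto
qed

lemma F_increasing_trees_1: "F_increasing_trees k 1 = {\<lambda>_ _. None}"
proof -
  have "(\<forall>u i v. f u i \<noteq> Some v) \<longleftrightarrow> f = (\<lambda>_ _. None)" for f :: "nat \<Rightarrow> nat \<Rightarrow> nat option"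
    by (simp add: fun_eq_iff not_Some_eq)
  then show ?thesis
    unfolding F_increasing_trees_eq[OF order_refl] placement_tree_1 by auto
qed

text \<open>Both families satisfy the same recursion in \<open>n\<close> and start with a single
  tree. Finiteness is carried along because the cardinality of the dependent sums and the final
  passage from equal cardinalities to a bijection rely on it.\<close>

lemma card_F_increasing_trees_eq_card_bundled:
  assumes "n \<ge> 1"
  shows "finite (F_increasing_trees k n) \<and> finite (bundled_increasing_trees k n) \<and>
    card (F_increasing_trees k n) = card (bundled_increasing_trees k n)"
  using assms
proof (induction n rule: nat_induct_at_least)
  case base
  show ?case unfolding bundled_increasing_trees_1 F_increasing_trees_1 by simp
next
  case (Suc n)
  let ?F = "F_increasing_trees k" and ?B = "bundled_increasing_trees k"
  let ?SF = "SIGMA f:?F n. free_positions k n f" and ?SB = "SIGMA b:?B n. bundle_gaps k n b"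
  have "finite ?SF" "finite ?SB"
    using Suc.IH card_free_positions(1)[OF Suc.hyps] card_bundle_gaps(1)[OF Suc.hyps]
    by (auto intro!: finite_SigmaI)
  \<comment> \<open>Every tree of order \<open>n\<close> offers the same number of places, so the
    sum over trees collapses to a product.\<close>
  moreover have "card ?SF = card (?F n) * (n * k + (n - 1))"
    using Suc.IH card_free_positions[OF Suc.hyps] by (simp add: card_SigmaI)
  moreover have "card ?SB = card (?B n) * (n * k + (n - 1))"
    using Suc.IH card_bundle_gaps[OF Suc.hyps] by (simp add: card_SigmaI)
  ultimately show ?case
    using bij_betw_finite[OF bij_betw_F_insert[OF Suc.hyps, of k]]
      bij_betw_finite[OF bij_betw_bundle_insert[OF Suc.hyps, of k]]
      bij_betw_same_card[OF bij_betw_F_insert[OF Suc.hyps, of k]]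
      bij_betw_same_card[OF bij_betw_bundle_insert[OF Suc.hyps, of k]] Suc.IH
    by simp
qed

theorem theorem4p4:
  fixes k n :: nat
  assumes "k \<ge> 1" and "n \<ge> 1"
  shows "\<exists>\<Phi>. bij_betw \<Phi> (F_increasing_trees k n) (bundled_increasing_trees k n)"
  using card_F_increasing_trees_eq_card_bundled[OF assms(2)] by (auto intro: finite_same_card_bij)

end
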